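(* Let $\mu$ be a Borel probability measure on $[0,1]$ with infinite support. Let $n\ge1$ be an integer and let $\mu_1$ be the measure given by $d\mu_1(x)=(1-x)\,d\mu(x)$. Then: (i) $\Omega(\mu,2n-1)=x_{n,1}$, where $x_{n,1}$ is the smallest zero of $\Psi_n(x;d\mu)$. Moreover, any extremizer must be of the form $$p(x)=C\,\frac{\big(\Psi_n(x;d\mu)\big)^2}{x-x_{n,1}},\qquad C>0.$$ (ii) $\Omega(\mu,2n)=\xi_{n,1}$, where $\xi_{n,1}$ is the smallest zero of $\Psi_n(x;d\mu_1)$. Moreover, any extremizer must be of the form $$p(x)=C(1-x)\,\frac{\big(\Psi_n(x;d\mu_1)\big)^2}{x-\xi_{n,1}},\qquad C>0.$$
   Context: A function $p:[0,1]\to\mathbb{R}$ is eventually non-negative if there is $r>0$ with $p(x)\ge0$ for all $x\in[0,1]\setminus[0,r)$, and its radius of last sign change is $\mathrm{r}(p)=\inf\{r>0:p(x)\ge0\text{ for all }x\in[0,1]\setminus[0,r)\}$. For a finite Borel measure $\mu$ on $[0,1]$ and $N\ge1$, $\mathcal{P}(\mu,N)$ is the set of real polynomials $p(x)=\sum_{k=0}^Na_kx^k$ that are eventually non-negative on $[0,1]$ and satisfy $\int_0^1p\,d\mu\le0$. Set $\Omega(\mu,N)=\inf_{0\not\equiv p\in\mathcal{P}(\mu,N)}\mathrm{r}(p)$. An extremizer for $\Omega(\mu,N)$ is a $0\not\equiv p\in\mathcal{P}(\mu,N)$ with $\mathrm{r}(p)=\Omega(\mu,N)$. For a finite Borel measure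 $\nu$ on $[0,1]$ with infinite support, $\Psi_n(x;d\nu)$, $n\ge0$, denotes the monic orthogonal polynomial of degree $n$ in $L^2(\mathbb{R},d\nu)$. *)

theory Defs
  imports "HOL-Probability.Probability" "HOL-Computational_Algebra.Polynomial"
begin

text \<open>
  As \<open>r > 1\<close> is allowed, every \<open>p\<close> satisfies \<^term>\<open>eventually_nonneg\<close>, and \<open>last_sign_change\<close>
  of a function with \<open>p 1 < 0\<close> is \<open>1\<close>; the set below is never empty.
\<close>

definition eventually_nonneg :: "(real \<Rightarrow> real) \<Rightarrow> bool" where
  "eventually_nonneg p \<longleftrightarrow> (\<exists>r>0. \<forall>x \<in> {0..1} - {0..<r}. p x \<ge> 0)"

definition last_sign_change :: "(real \<Rightarrow> real) \<Rightarrow> real" where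
  "last_sign_change p = Inf {r. r > 0 \<and> (\<forall>x \<in> {0..1} - {0..<r}. p x \<ge> 0)}"

text \<open>
  A Borel measure on \<open>[0,1]\<close> is represented as a Borel measure on the real line that vanishes
  outside \<open>[0,1]\<close>.
\<close>

definition borel_measure_on_unit_interval :: "real measure \<Rightarrow> bool" where
  "borel_measure_on_unit_interval \<mu> \<longleftrightarrow> sets \<mu> = sets borel \<and> emeasure \<mu> (- {0..1}) = 0"

definition measure_support :: "real measure \<Rightarrow> real set" where
  "measure_support \<mu> = {x. \<forall>U. open U \<longrightarrow> x \<in> U \<longrightarrow> emeasure \<mu> U > 0}"

definition sign_class :: "real measure \<Rightarrow> nat \<Rightarrow> real poly set" where
  "sign_class \<mu> N =
    {p. degree p \<le> N \<and> eventually_nonneg (poly p) \<and> (LINT x:{0..1}|\<mu>. poly p x) \<le> 0}"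

definition Omega :: "real measure \<Rightarrow> nat \<Rightarrow> real" where
  "Omega \<mu> N = (INF p \<in> sign_class \<mu> N - {0}. last_sign_change (poly p))"

definition extremizer :: "real measure \<Rightarrow> nat \<Rightarrow> real poly \<Rightarrow> bool" where
  "extremizer \<mu> N p \<longleftrightarrow>
    p \<in> sign_class \<mu> N \<and> p \<noteq> 0 \<and> last_sign_change (poly p) = Omega \<mu> N"

definition monic_orthogonal_sequence :: "real measure \<Rightarrow> (nat \<Rightarrow> real poly) \<Rightarrow> bool" where
  "monic_orthogonal_sequence \<nu> P \<longleftrightarrow>
    (\<forall>n. degree (P n) = n \<and> lead_coeff (P n) = 1) \<and>
    (\<forall>m n. m \<noteq> n \<longrightarrow> (LINT x|\<nu>. poly (P m) x * poly (P n) x) = 0)"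

text \<open>
  The sequence is unique when \<open>\<nu>\<close> is a finite measure on \<open>[0,1]\<close> with infinite support;
  otherwise \<open>Psi\<close> may be unspecified.
\<close>

definition Psi :: "real measure \<Rightarrow> nat \<Rightarrow> real poly" where
  "Psi \<nu> = (THE P. monic_orthogonal_sequence \<nu> P)"

definition smallest_zero :: "real poly \<Rightarrow> real" where
  "smallest_zero p = Min {x. poly p x = 0}"

text \<open>
  The measure \<open>(1 - x) d\<mu>(x)\<close>; the truncation of negative values by \<^const>\<open>ennreal\<close> only
  concerns \<open>x > 1\<close>, which is a null set for a measure on \<open>[0,1]\<close>.
\<close>

definition one_minus_x_measure :: "real measure \<Rightarrow> real measure" where
  "one_minus_x_measure \<mu> = density \<mu> (\<lambda>x. ennreal (1 - x))"

end

theory Submission imports Defs begin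

text \<open>
  Write \<open>L p\<close> for the integral of \<open>p\<close> against \<open>\<mu>\<close>, and let \<open>\<sigma>\<close> be \<open>1\<close> when the degree
  bound is \<open>2n - 1\<close> and \<open>1 - x\<close> when it is \<open>2n\<close>. Let \<open>V\<close> be the monic polynomial of degree \<open>n\<close>
  that is orthogonal to all lower degrees for the weight \<open>\<sigma>\<close>. It has \<open>n\<close> simple zeros in
  \<open>(0,1)\<close>; call their set \<open>S\<close> and its minimum \<open>s\<close>. The zeros of \<open>\<sigma> V\<close>, namely \<open>S\<close> and, in
  the second case, also \<open>1\<close>, are the nodes of the Gauss or Gauss--Radau quadrature formula
  \<open>L p = (\<Sum>z. w z * p z)\<close>, which has positive weights and is exact up to precisely the
  degree bound (lemma \<open>quadrature\<close>).

  Suppose that \<open>p\<close> is admissible and non-negative on \<open>[s,1]\<close>. All nodes lie there, so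
  \<open>L p \<le> 0\<close> forces \<open>p\<close> to vanish at every node. A node of \<open>S\<close> other than \<open>s\<close> is interior to
  \<open>[s,1]\<close>, and there a non-negative polynomial can only have a double zero. These zeros use up
  the degree, so \<open>p = c F\<close> with \<open>F = \<sigma> V\<^sup>2 / (x - s)\<close> and \<open>c \<ge> 0\<close> (lemma
  \<open>sign_constrained_form\<close>). Since \<open>F\<close> is negative to the left of \<open>s\<close>, no nonzero admissible
  polynomial has its last sign change before \<open>s\<close>, and those that have it at \<open>s\<close> are the
  positive multiples of \<open>F\<close>. Conversely \<open>F\<close> is admissible: it is \<open>\<sigma> V\<close> times a polynomial of
  degree \<open>n - 1\<close>, so \<open>L F = 0\<close>.

  The argument is carried out for a linear functional \<open>L\<close> that is positive on nonzero
  polynomials that are non-negative on \<open>[0,1]\<close>; integration against \<open>\<mu>\<close> has this property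
  because the support is infinite. The functional \<open>p \<mapsto> L (\<sigma> p)\<close> inherits it, so that both weights are
  instances of a single argument.
\<close>

section \<open>Monic polynomials with prescribed simple zeros\<close>

definition node_poly :: "real set \<Rightarrow> real poly" where
  "node_poly S = (\<Prod>z\<in>S. [:- z, 1:])"

lemma poly_node_poly: "poly (node_poly S) x = (\<Prod>z\<in>S. x - z)"
  by (simp add: node_poly_def poly_prod)

lemma poly_node_poly_eq_0_iff: "finite S \<Longrightarrow> poly (node_poly S) x = 0 \<longleftrightarrow> x \<in> S"
  by (auto simp: poly_node_poly)

lemma lead_coeff_node_poly: "lead_coeff (node_poly S) = 1"
  by (simp add: node_poly_def lead_coeff_prod)

lemma node_poly_nonzero: "node_poly S \<noteq> 0"
  using lead_coeff_node_poly[of S] by auto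

lemma degree_node_poly: "finite S \<Longrightarrow> degree (node_poly S) = card S"
  by (simp add: node_poly_def degree_prod_eq_sum_degree)

lemma node_poly_remove:
  "finite S \<Longrightarrow> z \<in> S \<Longrightarrow> node_poly S = [:- z, 1:] * node_poly (S - {z})"
  unfolding node_poly_def by (rule prod.remove)

lemma node_poly_insert:
  "finite S \<Longrightarrow> z \<notin> S \<Longrightarrow> node_poly (insert z S) = [:- z, 1:] * node_poly S"
  unfolding node_poly_def by (rule prod.insert)

lemma node_poly_dvd:
  assumes "finite S" "\<And>z. z \<in> S \<Longrightarrow> poly p z = 0"
  shows "node_poly S dvd p"
  using assms
proof (induction S arbitrary: p rule: finite_induct)
  case empty
  then show ?case by (simp add: node_poly_def)
next
  case (insert z S)
  from insert.prems have "[:- z, 1:] dvd p"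
    by (simp add: poly_eq_0_iff_dvd)
  then obtain q where q: "p = [:- z, 1:] * q" by (auto elim: dvdE)
  have "poly q y = 0" if "y \<in> S" for y
    using insert.prems[of y] insert.hyps that by (auto simp: q algebra_simps)
  then have "node_poly S dvd q" by (rule insert.IH)
  then show ?case
    unfolding q node_poly_insert[OF insert.hyps(1,2)] by (rule mult_dvd_mono[OF dvd_refl])
qed

lemma monic_eq_node_poly:
  assumes "finite S" "\<And>z. z \<in> S \<Longrightarrow> poly p z = 0" "lead_coeff p = 1" "degree p \<le> card S"
  shows "p = node_poly S"
proof -
  obtain q where q: "p = node_poly S * q"
    using node_poly_dvd[OF assms(1,2)] by (auto elim: dvdE)
  with assms(3) have "q \<noteq> 0" by auto
  then have "degree q = 0"
    using assms(1,4) unfolding q by (simp add: degree_mult_eq node_poly_nonzero degree_node_poly)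
  moreover have "lead_coeff q = 1"
    using assms(3) unfolding q lead_coeff_mult lead_coeff_node_poly by simp
  ultimately have "q = 1" by (auto elim: degree_eq_zeroE simp: one_pCons)
  then show ?thesis using q by simp
qed

section \<open>Signs and zeros of real polynomials\<close>

text \<open>
  The set \<open>S\<close> consists of the zeros of odd order in \<open>(0,1)\<close>. The induction on the degree keeps
  track of parities only: splitting off one linear factor toggles the membership of its zero
  in \<open>S\<close>. Without zeros in \<open>(0,1)\<close> the sign is constant by the intermediate value theorem.
\<close>

lemma sign_correction:
  fixes p :: "real poly"
  assumes "p \<noteq> 0"
  shows "\<exists>S \<subseteq> {0<..<1}. finite S \<and> (\<forall>z\<in>S. poly p z = 0) \<and>
     ((\<forall>x\<in>{0..1}. poly (p * node_poly S) x \<ge> 0) \<or> (\<forall>x\<in>{0..1}. poly (p * node_poly S) x \<le> 0))"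
  using assms
proof (induction "degree p" arbitrary: p rule: less_induct)
  case less
  show ?case
  proof (cases "\<exists>z\<in>{0<..<1}. poly p z = 0")
    case False
    have "\<not> (poly p a < 0 \<and> poly p b > 0)" if "a \<in> {0..1}" "b \<in> {0..1}" for a b
    proof
      assume ab: "poly p a < 0 \<and> poly p b > 0"
      then consider "a < b" | "b < a" by (metis linorder_less_linear order_less_asym)
      then show False
      proof cases
        case 1
        with ab poly_IVT_pos[of a b p] that False show False by force
      next
        case 2
        with ab poly_IVT_neg[of b a p] that False show False by force
      qed
    qed
    then have "(\<forall>x\<in>{0..1}. poly p x \<ge> 0) \<or> (\<forall>x\<in>{0..1}. poly p x \<le> 0)"
      by (meson not_le)
    then show ?thesis by (intro exI[of _ "{}"]) (simp add: node_poly_def)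
  next
    case True
    then obtain z where z: "z \<in> {0<..<1}" "poly p z = 0" by blast
    then obtain q where q: "p = [:- z, 1:] * q" by (auto simp: poly_eq_0_iff_dvd elim: dvdE)
    with less.prems have "q \<noteq> 0" by auto
    then have "degree q < degree p" unfolding q by (subst degree_mult_eq) auto
    from less.hyps[OF this \<open>q \<noteq> 0\<close>] obtain S where
      S: "S \<subseteq> {0<..<1}" "finite S" "\<forall>y\<in>S. poly q y = 0"
        "(\<forall>x\<in>{0..1}. poly (q * node_poly S) x \<ge> 0) \<or> (\<forall>x\<in>{0..1}. poly (q * node_poly S) x \<le> 0)"
      by blast
    show ?thesis
    proof (cases "z \<in> S")
      case True
      have "p * node_poly (S - {z}) = q * node_poly S"
        unfolding q node_poly_remove[OF S(2) True] by (simp only: ac_simps)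
      then show ?thesis using S by (intro exI[of _ "S - {z}"]) (auto simp: q)
    next
      case False
      have "poly (p * node_poly (insert z S)) x = (x - z)\<^sup>2 * poly (q * node_poly S) x" for x
        unfolding q node_poly_insert[OF S(2) False] by (simp add: power2_eq_square algebra_simps)
      then have "(\<forall>x\<in>{0..1}. poly (p * node_poly (insert z S)) x \<ge> 0)
          \<or> (\<forall>x\<in>{0..1}. poly (p * node_poly (insert z S)) x \<le> 0)"
        using S(4) by (auto simp: mult_nonneg_nonneg mult_nonneg_nonpos)
      then show ?thesis using S z
        by (intro exI[of _ "insert z S"]) (auto simp: q)
    qed
  qed
qed

text \<open>The zero \<open>z\<close> is an interior minimum, and \<open>h z\<close> is the derivative of the product there.\<close>
lemma zero_of_nonneg_is_double:
  fixes h :: "real poly"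
  assumes "a < z" "z < b" and "\<And>x. x \<in> {a<..<b} \<Longrightarrow> poly ([:- z, 1:] * h) x \<ge> 0"
  shows "poly h z = 0"
proof (rule DERIV_local_min)
  show "(poly ([:- z, 1:] * h) has_real_derivative poly h z) (at z)"
    by (rule DERIV_cong[OF poly_DERIV]) (simp only: pderiv_mult pderiv_pCons, simp)
  show "0 < min (z - a) (b - z)" using assms by simp
  show "\<forall>y. \<bar>z - y\<bar> < min (z - a) (b - z) \<longrightarrow> poly ([:- z, 1:] * h) z \<le> poly ([:- z, 1:] * h) y"
  proof (intro allI impI)
    fix y assume "\<bar>z - y\<bar> < min (z - a) (b - z)"
    then have "y \<in> {a<..<b}" by auto
    from assms(3)[OF this] show "poly ([:- z, 1:] * h) z \<le> poly ([:- z, 1:] * h) y" by simp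
  qed
qed

section \<open>The extremal polynomial and its last sign change\<close>

text \<open>
  This is \<open>\<sigma> V\<^sup>2 / (x - s)\<close> for \<open>V = node_poly S\<close> and \<open>s = Min S\<close>, written without division.
\<close>

definition extremal_poly :: "real poly \<Rightarrow> real set \<Rightarrow> real poly" where
  "extremal_poly \<sigma> S = \<sigma> * node_poly S * node_poly (S - {Min S})"

lemma extremal_poly_nonzero: "\<sigma> \<noteq> 0 \<Longrightarrow> extremal_poly \<sigma> S \<noteq> 0"
  by (simp add: extremal_poly_def node_poly_nonzero)

lemma degree_extremal_poly:
  assumes "\<sigma> \<noteq> 0" "finite S" "S \<noteq> {}"
  shows "degree (extremal_poly \<sigma> S) = 2 * card S - 1 + degree \<sigma>"
proof -
  have "card S > 0" using assms by (simp add: card_gt_0_iff)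
  then show ?thesis using assms
    by (simp add: extremal_poly_def degree_mult_eq node_poly_nonzero degree_node_poly)
qed

text \<open>The sign on \<open>[0,1)\<close> is that of \<open>x - Min S\<close>, except for the double zeros in the square.\<close>
lemma poly_extremal_poly:
  assumes "finite S" "S \<noteq> {}"
  shows "poly (extremal_poly \<sigma> S) x = poly \<sigma> x * (x - Min S) * (poly (node_poly (S - {Min S})) x)\<^sup>2"
  unfolding extremal_poly_def node_poly_remove[OF assms(1) Min_in[OF assms]]
  by (simp add: power2_eq_square algebra_simps)

lemma nonneg_beyond_last_sign_change:
  assumes "last_sign_change f < x" "x \<in> {0..1}"
  shows "f x \<ge> 0"
proof -
  let ?R = "{r. r > 0 \<and> (\<forall>x \<in> {0..1} - {0..<r}. f x \<ge> 0)}"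
  have "2 \<in> ?R" by auto
  moreover have "bdd_below ?R" by (rule bdd_belowI[of _ 0]) auto
  ultimately obtain r where "r \<in> ?R" "r < x"
    using assms(1) cInf_lessD[of ?R x] unfolding last_sign_change_def by blast
  with assms(2) show ?thesis by auto
qed

lemma last_sign_change_extremal_poly:
  assumes S: "S \<subseteq> {0<..<1}" "finite S" "S \<noteq> {}"
    and sigma: "\<sigma> = 1 \<or> \<sigma> = [:1, - 1:]" and c: "c > 0"
  shows "last_sign_change (poly (smult c (extremal_poly \<sigma> S))) = Min S"
proof -
  define s where "s = Min S"
  have "s \<in> S" using S by (simp add: s_def)
  then have s: "0 < s" "s < 1" using S(1) by auto
  let ?f = "poly (smult c (extremal_poly \<sigma> S))"
  note f = poly_extremal_poly[OF S(2,3), folded s_def]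
  have nonneg: "?f x \<ge> 0" if "s \<le> x" "x \<le> 1" for x
    using that sigma c by (auto simp: f intro!: mult_nonneg_nonneg)
  have neg: "?f x < 0" if "x < s" for x
  proof -
    have "poly \<sigma> x > 0" using sigma that s by auto
    moreover have "x \<notin> S" using that S by (auto simp: s_def)
    then have "poly (node_poly (S - {s})) x \<noteq> 0" using S by (simp add: poly_node_poly_eq_0_iff)
    ultimately show ?thesis using that c
      by (simp add: f mult_pos_neg mult_neg_pos)
  qed
  have "{r. r > 0 \<and> (\<forall>x \<in> {0..1} - {0..<r}. ?f x \<ge> 0)} = {s..}"
  proof (intro set_eqI iffI)
    fix r assume r: "r \<in> {r. r > 0 \<and> (\<forall>x \<in> {0..1} - {0..<r}. ?f x \<ge> 0)}"
    then show "r \<in> {s..}"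
      using neg[of r] s by (cases "r < s") force+
  next
    fix r assume "r \<in> {s..}"
    then show "r \<in> {r. r > 0 \<and> (\<forall>x \<in> {0..1} - {0..<r}. ?f x \<ge> 0)}"
      using s nonneg by force
  qed
  then show ?thesis unfolding last_sign_change_def s_def by simp
qed

section \<open>Orthogonal polynomials for a positive functional\<close>

locale positive_functional =
  fixes L :: "real poly \<Rightarrow> real"
  assumes add: "L (p + q) = L p + L q"
    and smult: "L (smult c p) = c * L p"
    and pos: "p \<noteq> 0 \<Longrightarrow> (\<And>x. x \<in> {0..1} \<Longrightarrow> poly p x \<ge> 0) \<Longrightarrow> L p > 0"
begin

lemma zero: "L 0 = 0"
  using smult[of 0 0] by simp

lemma diff: "L (p - q) = L p - L q"
  using add[of p "smult (- 1) q"] smult[of "- 1" q] by simp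

lemma sum: "L (\<Sum>i\<in>A. f i) = (\<Sum>i\<in>A. L (f i))"
  by (induction A rule: infinite_finite_induct) (simp_all add: zero add)

lemma square_pos: "p \<noteq> 0 \<Longrightarrow> L (p * p) > 0"
  by (rule pos) auto

lemma weighted:
  assumes "w \<noteq> 0" "\<And>x. x \<in> {0..1} \<Longrightarrow> poly w x \<ge> 0"
  shows "positive_functional (\<lambda>p. L (w * p))"
proof
  fix p :: "real poly"
  assume "p \<noteq> 0" "\<And>x. x \<in> {0..1} \<Longrightarrow> poly p x \<ge> 0"
  then show "L (w * p) > 0" using assms by (intro pos) auto
qed (simp_all add: add smult distrib_left)

text \<open>Polynomials of degrees \<open>0, \<dots>, n - 1\<close> span everything of degree less than \<open>n\<close>.\<close>
lemma orthogonal_lower_degree: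
  assumes P: "\<And>k. k < n \<Longrightarrow> degree (P k) = k \<and> lead_coeff (P k) = 1"
    and orth: "\<And>k. k < n \<Longrightarrow> L (Q * P k) = 0"
    and q: "degree q < n"
  shows "L (Q * q) = 0"
  using q
proof (induction "degree q" arbitrary: q rule: less_induct)
  case less
  define d where "d = degree q"
  define r where "r = q - smult (lead_coeff q) (P d)"
  have d: "degree (P d) = d" "lead_coeff (P d) = 1" "L (Q * P d) = 0"
    using P[of d] orth[of d] less.prems by (auto simp: d_def)
  have split: "L (Q * q) = L (Q * r) + lead_coeff q * L (Q * P d)"
    unfolding r_def by (simp add: right_diff_distrib diff smult)
  have "L (Q * r) = 0"
  proof (cases "d = 0")
    case True
    then have "r = 0"
      using d by (auto simp: r_def d_def elim!: degree_eq_zeroE)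
    then show ?thesis by (simp add: zero)
  next
    case False
    have "degree r \<le> d" unfolding r_def
      by (rule degree_diff_le) (use d in \<open>auto simp: d_def\<close>)
    moreover have "coeff r d = 0" using d by (simp add: r_def d_def)
    ultimately have "degree r < d"
      using False by (metis leading_coeff_0_iff degree_0 le_neq_implies_less not_gr_zero)
    then show ?thesis using less by (simp add: d_def)
  qed
  then show ?case using split d by simp
qed

text \<open>Gram--Schmidt, applied to the monomials.\<close>
lemma ex_monic_orthogonal:
  "\<exists>Q. degree Q = n \<and> lead_coeff Q = 1 \<and> (\<forall>q. degree q < n \<longrightarrow> L (Q * q) = 0)"
proof (induction n rule: less_induct)
  case (less n)
  then obtain P where P: "\<And>k. k < n \<Longrightarrow> degree (P k) = k \<and> lead_coeff (P k) = 1 \<and>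
      (\<forall>q. degree q < k \<longrightarrow> L (P k * q) = 0)"
    by metis
  define c where "c k = L (monom 1 n * P k) / L (P k * P k)" for k
  define R where "R = (\<Sum>k<n. smult (c k) (P k))"
  define Q where "Q = monom 1 n - R"
  have orth: "L (P k * P j) = 0" if "k < n" "j < n" "k \<noteq> j" for k j
    using P[of k] P[of j] that by (metis linorder_neqE_nat mult.commute)
  have "L (Q * P j) = 0" if j: "j < n" for j
  proof -
    have "L (R * P j) = (\<Sum>k<n. c k * L (P k * P j))"
      by (simp add: R_def sum_distrib_right sum smult)
    also have "\<dots> = c j * L (P j * P j)"
      using j orth by (subst sum.remove[of _ j]) auto
    also have "\<dots> = L (monom 1 n * P j)"
      using square_pos[of "P j"] P[OF j] by (force simp: c_def)
    finally show ?thesis by (simp add: Q_def left_diff_distrib diff)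
  qed
  then have "L (Q * q) = 0" if "degree q < n" for q
    using orthogonal_lower_degree[of n P Q q] P that by blast
  moreover have "coeff R k = 0" if "k \<ge> n" for k
    unfolding R_def coeff_sum using P that by (auto intro!: sum.neutral simp: coeff_eq_0)
  then have cQ: "coeff Q n = 1" "\<And>k. k > n \<Longrightarrow> coeff Q k = 0"
    by (auto simp: Q_def)
  then have "degree Q = n"
    by (intro antisym degree_le le_degree) auto
  ultimately show ?case using cQ by auto
qed

text \<open>
  The difference of two candidates has lower degree, hence is orthogonal to both and so to
  itself.
\<close>
lemma monic_orthogonal_unique:
  assumes "degree P = n" "lead_coeff P = 1" "\<And>q. degree q < n \<Longrightarrow> L (P * q) = 0"
    and "degree Q = n" "lead_coeff Q = 1" "\<And>q. degree q < n \<Longrightarrow> L (Q * q) = 0"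
  shows "P = Q"
proof (rule ccontr)
  assume "P \<noteq> Q"
  have "degree (P - Q) \<le> n" by (rule degree_diff_le) (use assms in auto)
  moreover have "coeff (P - Q) n = 0" using assms by auto
  ultimately have "degree (P - Q) < n"
    using \<open>P \<noteq> Q\<close> by (metis leading_coeff_0_iff le_neq_implies_less right_minus_eq)
  then have "L ((P - Q) * (P - Q)) = 0"
    using assms(3,6) by (simp add: left_diff_distrib[of P Q "P - Q"] diff)
  then show False using square_pos[of "P - Q"] \<open>P \<noteq> Q\<close> by simp
qed

lemma ex1_monic_orthogonal_sequence:
  "\<exists>!P. (\<forall>n. degree (P n) = n \<and> lead_coeff (P n) = 1) \<and> (\<forall>m n. m \<noteq> n \<longrightarrow> L (P m * P n) = 0)"
proof -
  obtain P where P: "\<And>n. degree (P n) = n \<and> lead_coeff (P n) = 1 \<and>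
      (\<forall>q. degree q < n \<longrightarrow> L (P n * q) = 0)"
    using ex_monic_orthogonal by metis
  show ?thesis
  proof (rule ex1I[of _ P], intro conjI allI impI)
    show "degree (P n) = n" "lead_coeff (P n) = 1" for n using P[of n] by auto
    show "L (P m * P n) = 0" if "m \<noteq> n" for m n
      using P[of m] P[of n] that by (metis linorder_neqE_nat mult.commute)
  next
    fix R assume R: "(\<forall>n. degree (R n) = n \<and> lead_coeff (R n) = 1) \<and>
      (\<forall>m n. m \<noteq> n \<longrightarrow> L (R m * R n) = 0)"
    have "R n = P n" for n
    proof (rule monic_orthogonal_unique)
      show "L (R n * q) = 0" if "degree q < n" for q
        by (rule orthogonal_lower_degree[of n R]) (use R that in \<open>metis less_irrefl\<close>)+
    qed (use R P in blast)+
    then show "R = P" by auto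
  qed
qed

text \<open>
  If \<open>V\<close> had fewer than \<open>n\<close> sign changes in \<open>(0,1)\<close>, then multiplying it by the polynomial of
  lower degree that vanishes at them would give a product of one sign whose integral is zero.
\<close>
lemma orthogonal_zeros:
  assumes V: "degree V = n" "lead_coeff V = 1" "\<And>q. degree q < n \<Longrightarrow> L (V * q) = 0"
  obtains S where "S \<subseteq> {0<..<1}" "finite S" "card S = n" "V = node_poly S"
proof -
  have "V \<noteq> 0" using V(2) by auto
  from sign_correction[OF this] obtain S where S: "S \<subseteq> {0<..<1}" "finite S" "\<forall>z\<in>S. poly V z = 0"
     "(\<forall>x\<in>{0..1}. poly (V * node_poly S) x \<ge> 0) \<or> (\<forall>x\<in>{0..1}. poly (V * node_poly S) x \<le> 0)"
    by blast
  have nz: "V * node_poly S \<noteq> 0" using \<open>V \<noteq> 0\<close> node_poly_nonzero by auto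
  from S(4) have "L (V * node_poly S) \<noteq> 0"
  proof
    assume "\<forall>x\<in>{0..1}. poly (V * node_poly S) x \<ge> 0"
    with pos[OF nz] show ?thesis by force
  next
    assume "\<forall>x\<in>{0..1}. poly (V * node_poly S) x \<le> 0"
    with pos[of "smult (- 1) (V * node_poly S)"] nz have "L (smult (- 1) (V * node_poly S)) > 0"
      by auto
    then show ?thesis unfolding smult by simp
  qed
  then have "n \<le> card S" using V(3)[of "node_poly S"] S(2) by (force simp: degree_node_poly)
  then have eq: "V = node_poly S" using S V by (intro monic_eq_node_poly) auto
  with V S(2) have "card S = n" by (simp add: degree_node_poly)
  with eq S that show thesis by blast
qed

section \<open>Gauss quadrature\<close>

text \<open>
  Subtracting the Lagrange interpolant of \<open>p\<close> leaves a multiple of \<open>node_poly Z\<close>, which \<open>L\<close>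
  kills; this gives the formula with some weights. Applied to the square of a Lagrange basis
  polynomial, it isolates a single weight and shows that it is positive. The bound on \<open>card Z\<close>
  is what makes the formula exact for these squares. With \<open>card Z = k\<close> this is Gauss quadrature,
  with \<open>card Z = Suc k\<close> Gauss--Radau quadrature.
\<close>

lemma quadrature:
  assumes Z: "finite Z" "card Z \<le> Suc k"
    and orth: "\<And>q. degree q < k \<Longrightarrow> L (node_poly Z * q) = 0"
  obtains w where "\<And>z. z \<in> Z \<Longrightarrow> w z > 0"
    "\<And>p. degree p < card Z + k \<Longrightarrow> L p = (\<Sum>z\<in>Z. w z * poly p z)"
proof -
  define u where "u z = node_poly (Z - {z})" for z
  define v where "v z = L (u z) / poly (u z) z" for z
  have uz: "poly (u z) z \<noteq> 0" for z
    using Z by (simp add: u_def poly_node_poly_eq_0_iff)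
  have uy: "poly (u z) y = 0" if "y \<in> Z" "y \<noteq> z" for y z
    using Z that by (simp add: u_def poly_node_poly_eq_0_iff)
  have deg_u: "degree (u z) < card Z" if "z \<in> Z" for z
    using Z that card_Diff1_less[of Z z] by (simp add: u_def degree_node_poly)
  have formula: "L p = (\<Sum>z\<in>Z. v z * poly p z)" if p: "degree p < card Z + k" for p
  proof -
    \<comment> \<open>the Lagrange interpolant of \<open>p\<close> at the nodes\<close>
    define I where "I = (\<Sum>z\<in>Z. smult (poly p z / poly (u z) z) (u z))"
    have "poly I y = poly p y" if "y \<in> Z" for y
    proof -
      have "poly I y = (\<Sum>z\<in>Z. poly p z / poly (u z) z * poly (u z) y)"
        by (simp add: I_def poly_sum)
      also have "\<dots> = poly p y"
        using Z that uy uz[of y] by (subst sum.remove[of _ y]) auto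
      finally show ?thesis .
    qed
    then obtain q where q: "p - I = node_poly Z * q"
      using node_poly_dvd[of Z "p - I"] Z by (auto elim: dvdE)
    have "L (p - I) = 0"
    proof (cases "q = 0")
      case True
      then show ?thesis using q by (simp add: zero)
    next
      case False
      have "card Z + k > 0" using p by auto
      moreover have "degree I < card Z + k" if "Z \<noteq> {}"
      proof -
        have "degree I \<le> card Z - 1" unfolding I_def
          by (rule degree_sum_le) (use Z deg_u in \<open>force intro: le_trans[OF degree_smult_le]\<close>)+
        moreover have "card Z > 0" using Z that by (simp add: card_gt_0_iff)
        ultimately show ?thesis by linarith
      qed
      moreover have "degree I < card Z + k" if "Z = {}"
        using that p by (simp add: I_def)
      ultimately have "degree (p - I) < card Z + k"
        using p by (metis degree_diff_less)
      then have "degree q < k"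
        using False Z unfolding q by (simp add: degree_mult_eq node_poly_nonzero degree_node_poly)
      then show ?thesis using orth q by simp
    qed
    then have "L p = L I" by (simp add: diff)
    also have "\<dots> = (\<Sum>z\<in>Z. v z * poly p z)"
      by (simp add: I_def sum smult v_def mult.commute)
    finally show ?thesis .
  qed
  have "v z > 0" if z: "z \<in> Z" for z
  proof -
    have "degree (u z * u z) < card Z + k"
      using degree_mult_le[of "u z" "u z"] deg_u[OF z] Z(2) by linarith
    from formula[OF this] have "L (u z * u z) = (\<Sum>y\<in>Z. v y * (poly (u z) y)\<^sup>2)"
      by (simp add: power2_eq_square)
    also have "\<dots> = v z * (poly (u z) z)\<^sup>2"
      using Z z uy by (subst sum.remove[of _ z]) auto
    finally have "v z * (poly (u z) z)\<^sup>2 > 0"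
      using square_pos[of "u z"] by (simp add: u_def node_poly_nonzero)
    then show ?thesis by (simp add: zero_less_mult_iff)
  qed
  with formula that show thesis by blast
qed

section \<open>The extremal problem\<close>

text \<open>
  The \<open>card S + degree \<sigma>\<close> nodes and a second zero at each element of \<open>S\<close> other than \<open>Min S\<close>
  make \<open>2 * card S - 1 + degree \<sigma>\<close> zeros, which is the largest degree allowed.
\<close>

lemma sign_constrained_form:
  assumes S: "S \<subseteq> {0<..<1}" "finite S" "S \<noteq> {}"
    and sigma: "\<sigma> = 1 \<or> \<sigma> = [:1, - 1:]"
    and orth: "\<And>q. degree q < card S \<Longrightarrow> L (\<sigma> * node_poly S * q) = 0"
    and p: "degree p < 2 * card S + degree \<sigma>" "L p \<le> 0" "\<And>x. x \<in> {Min S..1} \<Longrightarrow> poly p x \<ge> 0"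
  shows "\<exists>c\<ge>0. p = smult c (extremal_poly \<sigma> S)"
proof -
  define s where "s = Min S"
  have s: "s \<in> S" "\<And>z. z \<in> S \<Longrightarrow> s \<le> z" using S by (auto simp: s_def)
  have S1: "1 \<notin> S" using S by auto
  \<comment> \<open>\<open>\<epsilon>\<close> accounts for \<open>1 - x\<close> being minus a monic polynomial\<close>
  obtain Z \<epsilon> where Z: "finite Z" "card Z = card S + degree \<sigma>" "S \<subseteq> Z" "Z \<subseteq> {s..1}"
      "node_poly Z = smult \<epsilon> (\<sigma> * node_poly S)"
    using sigma
  proof
    assume "\<sigma> = 1"
    then show thesis using that[of S 1] S s by fastforce
  next
    assume "\<sigma> = [:1, - 1:]"
    moreover have "insert 1 S \<subseteq> {s..1}" using S s by fastforce
    ultimately show thesis using that[of "insert 1 S" "- 1"] S S1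
      by (auto simp: node_poly_insert)
  qed
  have "\<sigma> \<noteq> 0" "degree \<sigma> \<le> 1" using sigma by auto
  have "L (node_poly Z * q) = 0" if "degree q < card S" for q
    using orth[OF that] unfolding Z(5) mult_smult_left smult by simp
  then obtain w where w: "\<And>z. z \<in> Z \<Longrightarrow> w z > 0"
      "\<And>p. degree p < card Z + card S \<Longrightarrow> L p = (\<Sum>z\<in>Z. w z * poly p z)"
    using quadrature[of Z "card S"] Z(1,2) \<open>degree \<sigma> \<le> 1\<close> by auto
  have nonneg: "w z * poly p z \<ge> 0" if "z \<in> Z" for z
    using that w(1)[OF that] p(3) Z(4) by (force simp: s_def)
  have "(\<Sum>z\<in>Z. w z * poly p z) = 0"
    using w(2)[of p] p(1,2) Z(2) sum_nonneg[of Z, OF nonneg] by force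
  then have pZ: "poly p z = 0" if "z \<in> Z" for z
    using sum_nonneg_eq_0_iff[OF Z(1) nonneg] w(1)[OF that] that by auto
  then obtain q' where "p = node_poly Z * q'"
    using node_poly_dvd[OF Z(1), of p] by (auto elim: dvdE)
  then obtain q where q: "p = \<sigma> * node_poly S * q"
    unfolding Z(5) by (metis mult_smult_left mult_smult_right)
  have "poly q z = 0" if "z \<in> S - {s}" for z
  proof -
    have z: "s < z" "z < 1" "z \<in> S" using that s S by force+
    define h where "h = \<sigma> * node_poly (S - {z}) * q"
    have "p = [:- z, 1:] * h"
      unfolding q h_def node_poly_remove[OF S(2) z(3)] by (simp only: ac_simps)
    moreover have "\<And>x. x \<in> {s<..<1} \<Longrightarrow> poly p x \<ge> 0" using p(3) by (simp add: s_def)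
    ultimately have "poly h z = 0" using zero_of_nonneg_is_double[of s z 1 h] z by simp
    moreover have "poly \<sigma> z \<noteq> 0" using sigma z by auto
    ultimately show ?thesis using S by (simp add: h_def poly_node_poly_eq_0_iff)
  qed
  then obtain r where "q = node_poly (S - {s}) * r"
    using node_poly_dvd[of "S - {s}" q] S by (auto elim: dvdE)
  then have r: "p = extremal_poly \<sigma> S * r"
    unfolding q extremal_poly_def s_def by (simp only: ac_simps)
  have "degree r = 0"
  proof (cases "r = 0")
    case False
    have "card S > 0" using S by (simp add: card_gt_0_iff)
    with False p(1) show ?thesis
      unfolding r using extremal_poly_nonzero[OF \<open>\<sigma> \<noteq> 0\<close>] degree_extremal_poly[OF \<open>\<sigma> \<noteq> 0\<close> S(2,3)]
      by (simp add: degree_mult_eq)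
  qed simp
  then obtain c where c: "p = smult c (extremal_poly \<sigma> S)"
    unfolding r by (auto elim: degree_eq_zeroE)
  \<comment> \<open>the sign of \<open>c\<close> is read off at a point of \<open>(s,1)\<close> where the extremal polynomial does not vanish\<close>
  have "infinite ({s<..<1} - S)" using S s by auto
  then obtain x where x: "x \<in> {s<..<1} - S" by (metis ex_in_conv finite.emptyI)
  then have "poly \<sigma> x > 0" using sigma by auto
  then have "poly (extremal_poly \<sigma> S) x > 0"
    using x S by (simp add: poly_extremal_poly s_def poly_node_poly_eq_0_iff)
  moreover have "c * poly (extremal_poly \<sigma> S) x \<ge> 0" using p(3)[of x] x c by (simp add: s_def)
  ultimately have "c \<ge> 0" by (simp add: zero_le_mult_iff)
  with c show ?thesis by blast
qed

text \<open>
  A polynomial whose last sign change came before \<open>s\<close> would be non-negative on \<open>[s,1]\<close>, hence a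
  positive multiple of the extremal polynomial, whose last sign change is \<open>s\<close>: a contradiction.
  For a polynomial whose last sign change is \<open>s\<close>, continuity supplies non-negativity at \<open>s\<close>
  itself, and the same description applies.
\<close>
lemma extremal_problem:
  fixes \<sigma> V :: "real poly"
  defines "s \<equiv> smallest_zero V"
  assumes sigma: "\<sigma> = 1 \<or> \<sigma> = [:1, - 1:]"
    and V: "degree V = n" "lead_coeff V = 1" "\<And>q. degree q < n \<Longrightarrow> L (\<sigma> * (V * q)) = 0"
    and n: "n \<ge> 1"
    and A: "A = {p. degree p \<le> 2 * n - 1 + degree \<sigma> \<and> L p \<le> 0} - {0}"
  shows "(INF p\<in>A. last_sign_change (poly p)) = s"
    and "p \<in> A \<Longrightarrow> last_sign_change (poly p) = s \<Longrightarrow>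
       \<exists>C>0. \<forall>x. x \<noteq> s \<longrightarrow> poly p x = C * poly \<sigma> x * ((poly V x)\<^sup>2 / (x - s))"
proof -
  have "\<sigma> \<noteq> 0" "\<And>x. x \<in> {0..1} \<Longrightarrow> poly \<sigma> x \<ge> 0" using sigma by auto
  then interpret weighted: positive_functional "\<lambda>p. L (\<sigma> * p)" by (rule weighted)
  obtain S where S: "S \<subseteq> {0<..<1}" "finite S" "card S = n" "V = node_poly S"
    using weighted.orthogonal_zeros[OF V] .
  have "S \<noteq> {}" using S n by auto
  have "{x. poly V x = 0} = S" using S by (simp add: poly_node_poly_eq_0_iff)
  then have s: "s = Min S" by (simp add: s_def smallest_zero_def)
  let ?F = "extremal_poly \<sigma> S"
  have "L ?F = 0"
    using V(3)[of "node_poly (S - {s})"] S n \<open>S \<noteq> {}\<close>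
    by (simp add: extremal_poly_def s degree_node_poly mult.assoc)
  then have FA: "?F \<in> A"
    using extremal_poly_nonzero[OF \<open>\<sigma> \<noteq> 0\<close>] degree_extremal_poly[OF \<open>\<sigma> \<noteq> 0\<close> S(2) \<open>S \<noteq> {}\<close>] S
    by (simp add: A)
  have lsc: "last_sign_change (poly (smult c ?F)) = s" if "c > 0" for c
    using last_sign_change_extremal_poly[OF S(1,2) \<open>S \<noteq> {}\<close> sigma that] s by simp
  have form: "\<exists>c>0. p = smult c ?F"
    if p: "p \<in> A" "\<And>x. x \<in> {s..1} \<Longrightarrow> poly p x \<ge> 0" for p
  proof -
    have "\<exists>c\<ge>0. p = smult c ?F"
    proof (rule sign_constrained_form[OF S(1,2) \<open>S \<noteq> {}\<close> sigma])
      show "L (\<sigma> * node_poly S * q) = 0" if "degree q < card S" for q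
        using V(3)[of q] that S by (simp add: mult.assoc)
      show "degree p < 2 * card S + degree \<sigma>" "L p \<le> 0" using p(1) S(3) n by (auto simp: A)
    qed (use p s in auto)
    moreover have "p \<noteq> 0" using p(1) by (simp add: A)
    ultimately show ?thesis by (metis order_le_less smult_0_left)
  qed
  have lower: "s \<le> last_sign_change (poly p)" if "p \<in> A" for p
  proof (rule ccontr)
    assume *: "\<not> s \<le> last_sign_change (poly p)"
    have "poly p x \<ge> 0" if "x \<in> {s..1}" for x
    proof (rule nonneg_beyond_last_sign_change[of "poly p"])
      have "s \<in> S" using S \<open>S \<noteq> {}\<close> by (simp add: s)
      then show "x \<in> {0..1}" using that S(1) by force
    qed (use that * in auto)
    from form[OF \<open>p \<in> A\<close> this] lsc * show False by auto
  qed
  show "(INF p\<in>A. last_sign_change (poly p)) = s"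
    using FA lsc[of 1] lower by (intro cInf_eq_minimum) (auto intro!: image_eqI[of _ _ ?F])
  show "\<exists>C>0. \<forall>x. x \<noteq> s \<longrightarrow> poly p x = C * poly \<sigma> x * ((poly V x)\<^sup>2 / (x - s))"
    if p: "p \<in> A" "last_sign_change (poly p) = s"
  proof -
    have "s \<in> S" using S \<open>S \<noteq> {}\<close> by (simp add: s)
    then have s1: "0 < s" "s < 1" using S(1) by auto
    have gt: "poly p x \<ge> 0" if "x \<in> {s<..1}" for x
      using that p(2) s1 nonneg_beyond_last_sign_change[of "poly p" x] by auto
    have "poly p s \<ge> 0"
    proof (rule tendsto_lowerbound)
      show "(poly p \<longlongrightarrow> poly p s) (at_right s)"
        by (intro tendsto_poly tendsto_ident_at)
      show "\<forall>\<^sub>F x in at_right s. 0 \<le> poly p x"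
        using eventually_at_right_real[OF s1(2)] by eventually_elim (use gt in auto)
    qed simp
    then have "poly p x \<ge> 0" if "x \<in> {s..1}" for x
      using gt[of x] that by (cases "x = s") auto
    from form[OF p(1) this] obtain c where c: "c > 0" "p = smult c ?F" by blast
    have "poly p x = c * poly \<sigma> x * ((poly V x)\<^sup>2 / (x - s))" if "x \<noteq> s" for x
    proof -
      have "V = [:- s, 1:] * node_poly (S - {s})"
        unfolding S(4) using S(2) \<open>s \<in> S\<close> by (rule node_poly_remove)
      then have "poly V x = (x - s) * poly (node_poly (S - {s})) x"
        by (simp only: poly_mult) simp
      then show ?thesis using that c S \<open>S \<noteq> {}\<close>
        by (simp add: poly_extremal_poly s power2_eq_square)
    qed
    with c show ?thesis by blast
  qed
qed

end

section \<open>Measures on the unit interval\<close>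

lemma open_null_set_disjoint_support:
  "open U \<Longrightarrow> emeasure M U = 0 \<Longrightarrow> U \<inter> measure_support M = {}"
  by (force simp: measure_support_def)

context
  fixes \<mu> :: "real measure"
  assumes fin: "finite_measure \<mu>" and unit: "borel_measure_on_unit_interval \<mu>"
begin

lemma sets_borel: "sets \<mu> = sets borel"
  using unit by (simp add: borel_measure_on_unit_interval_def)

lemma measurable_poly: "poly p \<in> borel_measurable \<mu>"
  unfolding measurable_cong_sets[OF sets_borel refl]
  by (intro borel_measurable_continuous_onI continuous_intros)

lemma AE_unit_interval: "AE x in \<mu>. x \<in> {0..1}"
  by (rule AE_I'[of "- {0..1}"])
     (use unit in \<open>auto simp: borel_measure_on_unit_interval_def null_sets_def\<close>)

lemma integrable_poly: "integrable \<mu> (poly p)"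
proof -
  interpret finite_measure \<mu> by (rule fin)
  have "bounded (poly p ` {0..1})"
    by (intro compact_imp_bounded compact_continuous_image continuous_intros) auto
  then obtain B where "\<forall>x\<in>{0..1}. norm (poly p x) \<le> B"
    unfolding bounded_iff by auto
  then show ?thesis
    using AE_unit_interval by (intro integrable_const_bound[of _ B] measurable_poly) auto
qed

lemma set_integral_unit_interval: "(LINT x:{0..1}|\<mu>. poly p x) = (LINT x|\<mu>. poly p x)"
  unfolding set_lebesgue_integral_def
proof (rule integral_cong_AE)
  have "(\<lambda>x. indicator {0..1} x *\<^sub>R poly p x) \<in> borel_measurable borel"
    by (intro borel_measurable_scaleR borel_measurable_indicator borel_measurable_continuous_onI
        continuous_intros) auto
  then show "(\<lambda>x. indicator {0..1} x *\<^sub>R poly p x) \<in> borel_measurable \<mu>"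
    unfolding measurable_cong_sets[OF sets_borel refl] .
qed (use AE_unit_interval measurable_poly in auto)

lemma integral_one_minus_x_measure:
  "(LINT x|one_minus_x_measure \<mu>. poly p x) = (LINT x|\<mu>. poly ([:1, - 1:] * p) x)"
proof -
  have "(\<lambda>x. 1 - x :: real) \<in> borel_measurable \<mu>"
    unfolding measurable_cong_sets[OF sets_borel refl] by simp
  moreover have "poly ([:1, - 1:] * p) = (\<lambda>x. (1 - x) *\<^sub>R poly p x)"
    by (rule ext) (simp add: algebra_simps)
  moreover have "AE x in \<mu>. 0 \<le> 1 - x" using AE_unit_interval by eventually_elim simp
  ultimately show ?thesis
    unfolding one_minus_x_measure_def by (simp add: integral_density measurable_poly)
qed

text \<open>
  A non-negative polynomial with integral zero vanishes almost everywhere. Its non-zeros form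
  an open null set, so the support of \<open>\<mu>\<close> consists of zeros; there are infinitely many only for
  the zero polynomial.
\<close>
lemma positive_functional_integral:
  assumes supp: "infinite (measure_support \<mu>)"
  shows "positive_functional (\<lambda>p. LINT x|\<mu>. poly p x)"
proof
  fix p :: "real poly"
  assume p: "p \<noteq> 0" "\<And>x. x \<in> {0..1} \<Longrightarrow> poly p x \<ge> 0"
  have nonneg: "AE x in \<mu>. 0 \<le> poly p x" using AE_unit_interval by eventually_elim (rule p(2))
  have "(LINT x|\<mu>. poly p x) \<noteq> 0"
  proof
    assume "(LINT x|\<mu>. poly p x) = 0"
    then have "AE x in \<mu>. poly p x = 0"
      using integral_nonneg_eq_0_iff_AE[OF integrable_poly nonneg] by simp
    then have "emeasure \<mu> {x. poly p x \<noteq> 0} = 0"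
      using sets_eq_imp_space_eq[OF sets_borel]
      by (subst (asm) AE_iff_measurable[OF _ refl])
         (auto simp: sets_borel intro!: borel_open open_Collect_neq continuous_intros)
    moreover have "open {x. poly p x \<noteq> 0}"
      by (intro open_Collect_neq continuous_intros)
    ultimately have "measure_support \<mu> \<subseteq> {x. poly p x = 0}"
      using open_null_set_disjoint_support by fastforce
    then show False using supp poly_roots_finite[OF p(1)] finite_subset by blast
  qed
  moreover have "(LINT x|\<mu>. poly p x) \<ge> 0" by (rule integral_nonneg_AE[OF nonneg])
  ultimately show "(LINT x|\<mu>. poly p x) > 0" by simp
next
  show "(LINT x|\<mu>. poly (p + q) x) = (LINT x|\<mu>. poly p x) + (LINT x|\<mu>. poly q x)" for p q
    by (simp add: integrable_poly)
qed simp

text \<open>Every \<open>r > 1\<close> witnesses eventual non-negativity, as no point of \<open>[0,1]\<close> lies beyond it.\<close>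
lemma sign_class_eq:
  "sign_class \<mu> N = {p. degree p \<le> N \<and> (LINT x|\<mu>. poly p x) \<le> 0}"
proof -
  have "eventually_nonneg f" for f
    unfolding eventually_nonneg_def by (rule exI[of _ 2]) auto
  then show ?thesis by (simp add: sign_class_def set_integral_unit_interval)
qed

end

text \<open>
  Existence and uniqueness of the orthogonal sequence make the description of \<^const>\<open>Psi\<close>
  proper. The lemma is used for \<open>\<nu> = \<mu>\<close> and for \<open>\<nu> = (1 - x) d\<mu>\<close>, whose functional is
  \<open>p \<mapsto> L ((1 - x) p)\<close>.
\<close>
lemma Psi_orthogonal:
  assumes "positive_functional L" "\<And>p. (LINT x|\<nu>. poly p x) = L p"
  shows "degree (Psi \<nu> n) = n" "lead_coeff (Psi \<nu> n) = 1"
    "degree q < n \<Longrightarrow> L (Psi \<nu> n * q) = 0"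
proof -
  interpret positive_functional L by fact
  have "(LINT x|\<nu>. poly p x * poly q x) = L (p * q)" for p q
    using assms(2)[of "p * q"] by simp
  then have "\<exists>!P. monic_orthogonal_sequence \<nu> P"
    unfolding monic_orthogonal_sequence_def using ex1_monic_orthogonal_sequence by simp
  then have "monic_orthogonal_sequence \<nu> (Psi \<nu>)"
    unfolding Psi_def by (rule theI')
  then have Psi: "\<And>n. degree (Psi \<nu> n) = n \<and> lead_coeff (Psi \<nu> n) = 1"
      "\<And>m n. m \<noteq> n \<Longrightarrow> L (Psi \<nu> m * Psi \<nu> n) = 0"
    using \<open>\<And>p q. (LINT x|\<nu>. poly p x * poly q x) = L (p * q)\<close>
    unfolding monic_orthogonal_sequence_def by metis+
  show "degree (Psi \<nu> n) = n" "lead_coeff (Psi \<nu> n) = 1" using Psi(1)[of n] by auto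
  show "L (Psi \<nu> n * q) = 0" if "degree q < n"
    by (rule orthogonal_lower_degree[of n "Psi \<nu>"]) (use Psi that in \<open>metis less_irrefl\<close>)+
qed

section \<open>Extremizers are squares of orthogonal polynomials divided by a linear factor\<close>

theorem theorem3:
  fixes \<mu> :: "real measure" and n :: nat
  assumes "prob_space \<mu>"
    and "borel_measure_on_unit_interval \<mu>"
    and "infinite (measure_support \<mu>)"
    and "n \<ge> 1"
  defines "\<mu>1 \<equiv> one_minus_x_measure \<mu>"
  defines "x1 \<equiv> smallest_zero (Psi \<mu> n)"
    and "\<xi>1 \<equiv> smallest_zero (Psi \<mu>1 n)"
  shows "(Omega \<mu> (2 * n - 1) = x1 \<and>
          (\<forall>p. extremizer \<mu> (2 * n - 1) p \<longrightarrow>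
            (\<exists>C>0. \<forall>x. x \<noteq> x1 \<longrightarrow> poly p x = C * ((poly (Psi \<mu> n) x)\<^sup>2 / (x - x1))))) \<and>
         (Omega \<mu> (2 * n) = \<xi>1 \<and>
          (\<forall>p. extremizer \<mu> (2 * n) p \<longrightarrow>
            (\<exists>C>0. \<forall>x. x \<noteq> \<xi>1 \<longrightarrow>
               poly p x = C * (1 - x) * ((poly (Psi \<mu>1 n) x)\<^sup>2 / (x - \<xi>1)))))"
proof -
  have fin: "finite_measure \<mu>" using assms(1) by (rule prob_space.axioms)
  note unit = \<open>borel_measure_on_unit_interval \<mu>\<close>
  define L where "L = (\<lambda>p. LINT x|\<mu>. poly p x)"
  interpret L: positive_functional L
    unfolding L_def by (rule positive_functional_integral[OF fin unit assms(3)])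
  have L1: "positive_functional (\<lambda>p. L ([:1, - 1:] * p))" by (rule L.weighted) auto
  have L1_eq: "(LINT x|\<mu>1. poly p x) = L ([:1, - 1:] * p)" for p
    unfolding L_def \<mu>1_def by (rule integral_one_minus_x_measure[OF fin unit])
  have admissible: "sign_class \<mu> N - {0} = {p. degree p \<le> N \<and> L p \<le> 0} - {0}" for N
    by (simp add: sign_class_eq[OF fin unit] L_def)
  have L_eq: "(LINT x|\<mu>. poly p x) = L p" for p by (simp add: L_def)
  note Psi = Psi_orthogonal[OF L.positive_functional_axioms L_eq]
  note Psi1 = Psi_orthogonal[OF L1 L1_eq]
  have *: "2 * n - 1 + degree (1 :: real poly) = 2 * n - 1"
    "2 * n - 1 + degree [:1, - 1 :: real:] = 2 * n" using \<open>n \<ge> 1\<close> by auto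
  have odd: "L (1 * (Psi \<mu> n * q)) = 0" if "degree q < n" for q using Psi(3)[OF that] by simp
  note odd_case = L.extremal_problem[of 1 "Psi \<mu> n", OF disjI1[OF refl] Psi(1,2) odd \<open>n \<ge> 1\<close> refl,
      unfolded *, folded admissible x1_def]
  note even_case = L.extremal_problem[of "[:1, - 1:]" "Psi \<mu>1 n", OF disjI2[OF refl] Psi1 \<open>n \<ge> 1\<close> refl,
      unfolded *, folded admissible \<xi>1_def]
  have Omega: "Omega \<mu> (2 * n - 1) = x1" "Omega \<mu> (2 * n) = \<xi>1"
    unfolding Omega_def using odd_case(1) even_case(1) by auto
  show ?thesis
    using Omega odd_case(2) even_case(2) by (simp add: extremizer_def)
qed

end
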